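(* Let $V$ be a finite-dimensional complex vector space, let $\mathcal{A}=\mathcal{A}^1_2\oplus\mathcal{A}^2_1$ with $\mathcal{A}^1_2=\mathrm{Hom}(V\otimes V,V)$ and $\mathcal{A}^2_1=\mathrm{Hom}(V,V\otimes V)$, and let $(\cdot,\cdot,\cdot):\mathcal{A}\times\mathcal{A}\times\mathcal{A}\to\mathcal{A}$ be the 3-commutator defined in the context, with coefficients $\alpha=1$, $\beta=e^{2\pi i/3}$, $\gamma=e^{4\pi i/3}$. This 3-ary operation on $\mathcal{A}$ is non-decomposable into binary ones, in the sense that every nonzero binary operation $\tau$ on $\mathcal{A}$ given by a linear combination of elementary binary contractions (see context) satisfies $\tau(\mathcal{A}\times\mathcal{A})\not\subset\mathcal{A}$; and for all $A,B,C,D,E\in\mathcal{A}$ the following identity holds: $$\begin{aligned} &((A,B,C),D,E)+((B,C,D),E,A)+((C,D,E),A,B)+((D,E,A),B,C)+((E,A,B),C,D)\\ +\,&((C,B,A),E,D)+((B,A,E),D,C)+((A,E,D),C,B)+((E,D,C),B,A)+((D,C,B),A,E)\\ +\,&((D,A,C),E,B)+((A,C,E),B,D)+((C,E,B),D,A)+((E,B,D),A,C)+((B,D,A),C,E)\\ +\,&((C,A,D),B,E)+((A,D,B),E,C)+((D,B,E),C,A)+((B,E,C),A,D)+((E,C,A),D,B)=0 . \end{aligned}$$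
   Context: Notation: $\mathcal{A}^p_q$ is the space of tensors with $p$ upper and $q$ lower indices, identified with $\mathrm{Hom}(V^{\otimes q},V^{\otimes p})$. An element $X\in\mathcal{A}$ is written $X=X^1_2+X^2_1$ with $X^1_2\in\mathcal{A}^1_2$ and $X^2_1\in\mathcal{A}^2_1$. Let $\sigma:V\otimes V\to V\otimes V$ be the flip $\sigma(u\otimes v)=v\otimes u$. Linear triple products: three tensors are contracted in a chain, and when the two upper indices of one tensor are contracted with the two lower indices of its neighbour, one sums over the two possible ways of pairing these indices. Explicitly, for $X,Y,Z\in\mathcal{A}$, $$X^2_1Y^1_2Z^2_1:=X^2_1\circ Y^1_2\circ(\mathrm{id}+\sigma)\circ Z^2_1\in\mathcal{A}^2_1,\qquad X^1_2Y^2_1Z^1_2:=X^1_2\circ(\mathrm{id}+\sigma)\circ Y^2_1\circ Z^1_2\in\mathcal{A}^1_2 .$$ The 3-commutator with coefficients $\alpha,\beta,\gamma$ is $$\begin{aligned} (X,Y,Z)=\;&\alpha\,X^2_1Y^1_2Z^2_1+\alpha\,Z^2_1Y^1_2X^2_1+\beta\,Z^2_1X^1_2Y^2_1+\beta\,Y^2_1X^1_2Z^2_1+\gamma\,X^2_1Z^1_2Y^2_1+\gamma\,Y^2_1Z^1_2X^2_1\\ +\;&\alpha\,X^1_2Y^2_1Z^1_2+\alpha\,Z^1_2Y^2_1X^1_2+\beta\,Z^1_2X^2_1Y^1_2+\beta\,Y^1_2X^2_1Z^1_2+\gamma\,X^1_2Z^2_1Y^1_2+\gamma\,Y^1_2Z^2_1X^1_2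 . \end{aligned}$$ Elementary binary contractions: an elementary binary contraction takes $(X,Y)\in\mathcal{A}\times\mathcal{A}$, chooses one of the two homogeneous components of $X$ and one of the two homogeneous components of $Y$, forms their tensor product, and contracts some (possibly empty) set of pairs consisting of an upper index of one of the two tensors and a lower index of the other. Its value lies in the mixed tensor algebra $\bigoplus_{p,q\ge 0}\mathcal{A}^p_q$, and a binary operation means a linear combination of such maps. *)

theory Defs
  imports Complex_Main "HOL-Library.FuncSet" "HOL-Library.Function_Algebras"
begin

text \<open>
  A tensor with \<open>p\<close> upper and \<open>q\<close> lower indices on a finite-dimensional space \<open>V\<close> is a
  multilinear form in \<open>p\<close> covectors and \<open>q\<close> vectors.  All tensors share one type: they take a
  list of covectors and a list of vectors and vanish on arguments outside of their domain.  Hence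
  sums of tensors of different degrees, the elements of the mixed tensor algebra, are pointwise
  sums of functions.
\<close>

type_synonym 'v tensor = "('v \<Rightarrow> complex) list \<Rightarrow> 'v list \<Rightarrow> complex"

definition smul :: "complex \<Rightarrow> 'v tensor \<Rightarrow> 'v tensor" where
  "smul c t = (\<lambda>fs vs. c * t fs vs)"

definition component :: "nat \<Rightarrow> nat \<Rightarrow> 'v tensor \<Rightarrow> 'v tensor" where
  "component p q t = (\<lambda>fs vs. if length fs = p \<and> length vs = q then t fs vs else 0)"

text \<open>Tensor product of \<open>s\<close>, with \<open>p\<close> upper and \<open>q\<close> lower indices, and \<open>t\<close>.\<close>

definition tensor_prod :: "nat \<Rightarrow> nat \<Rightarrow> 'v tensor \<Rightarrow> 'v tensor \<Rightarrow> 'v tensor" where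
  "tensor_prod p q s t = (\<lambda>fs vs. s (take p fs) (take q vs) * t (drop p fs) (drop q vs))"

text \<open>
  The library locale comes with a basis.  It is used only to write contractions
  as sums over the basis and its dual basis; their values do not depend on it.
\<close>

locale fin_dim_complex_space = finite_dimensional_vector_space scale Basis
  for scale :: "complex \<Rightarrow> 'v::ab_group_add \<Rightarrow> 'v" and Basis :: "'v set"
begin

definition covectors :: "('v \<Rightarrow> complex) set" where
  "covectors = {f. Vector_Spaces.linear scale (*) f}"

definition dual_basis :: "'v \<Rightarrow> 'v \<Rightarrow> complex" where
  "dual_basis b = (\<lambda>v. representation Basis v b)"

definition tensors :: "nat \<Rightarrow> nat \<Rightarrow> 'v tensor set" where
  "tensors p q = {t.
     (\<forall>fs vs. t fs vs \<noteq> 0 \<longrightarrow> length fs = p \<and> length vs = q \<and> set fs \<subseteq> covectors) \<and>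
     (\<forall>fs vs i f g c. set fs \<subseteq> covectors \<and> i < length fs \<and> f \<in> covectors \<and> g \<in> covectors \<longrightarrow>
        t (fs[i := \<lambda>v. c * f v + g v]) vs = c * t (fs[i := f]) vs + t (fs[i := g]) vs) \<and>
     (\<forall>fs vs i. i < length vs \<longrightarrow> Vector_Spaces.linear scale (*) (\<lambda>v. t fs (vs[i := v])))}"

definition \<A> :: "'v tensor set" where
  "\<A> = {s + t |s t. s \<in> tensors 1 2 \<and> t \<in> tensors 2 1}"

definition basis_lists :: "nat \<Rightarrow> 'v list set" where
  "basis_lists q = {bs. set bs \<subseteq> Basis \<and> length bs = q}"

text \<open>
  Composition of \<open>s\<close>, with \<open>q\<close> lower indices, and \<open>t\<close>, with \<open>q\<close> upper indices.
\<close>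

definition tensor_comp :: "nat \<Rightarrow> 'v tensor \<Rightarrow> 'v tensor \<Rightarrow> 'v tensor" where
  "tensor_comp q s t = (\<lambda>fs vs. \<Sum>bs\<in>basis_lists q. s fs bs * t (map dual_basis bs) vs)"

definition id2 :: "'v tensor" where
  "id2 = (\<lambda>fs vs. if length fs = 2 \<and> length vs = 2 \<and> set fs \<subseteq> covectors
                 then (fs ! 0) (vs ! 0) * (fs ! 1) (vs ! 1) else 0)"

definition flip :: "'v tensor" where
  "flip = (\<lambda>fs vs. if length fs = 2 \<and> length vs = 2 \<and> set fs \<subseteq> covectors
                  then (fs ! 0) (vs ! 1) * (fs ! 1) (vs ! 0) else 0)"

definition triple21 :: "'v tensor \<Rightarrow> 'v tensor \<Rightarrow> 'v tensor \<Rightarrow> 'v tensor" where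
  "triple21 X Y Z =
     tensor_comp 1 (component 2 1 X)
       (tensor_comp 2 (component 1 2 Y) (tensor_comp 2 (id2 + flip) (component 2 1 Z)))"

definition triple12 :: "'v tensor \<Rightarrow> 'v tensor \<Rightarrow> 'v tensor \<Rightarrow> 'v tensor" where
  "triple12 X Y Z =
     tensor_comp 2 (component 1 2 X)
       (tensor_comp 2 (id2 + flip) (tensor_comp 1 (component 2 1 Y) (component 1 2 Z)))"

definition three_commutator ::
  "complex \<Rightarrow> complex \<Rightarrow> complex \<Rightarrow> 'v tensor \<Rightarrow> 'v tensor \<Rightarrow> 'v tensor \<Rightarrow> 'v tensor" where
  "three_commutator \<alpha> \<beta> \<gamma> X Y Z =
     smul \<alpha> (triple21 X Y Z) + smul \<alpha> (triple21 Z Y X)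
   + smul \<beta> (triple21 Z X Y) + smul \<beta> (triple21 Y X Z)
   + smul \<gamma> (triple21 X Z Y) + smul \<gamma> (triple21 Y Z X)
   + smul \<alpha> (triple12 X Y Z) + smul \<alpha> (triple12 Z Y X)
   + smul \<beta> (triple12 Z X Y) + smul \<beta> (triple12 Y X Z)
   + smul \<gamma> (triple12 X Z Y) + smul \<gamma> (triple12 Y Z X)"

text \<open>
  Contraction of a tensor with \<open>P\<close> upper and \<open>Q\<close> lower indices along a set \<open>M\<close> of disjoint
  pairs (upper index, lower index).  The remaining indices keep their order: the uncontracted
  index \<open>i\<close> has position \<open>card ({..<i} - Domain M)\<close> among the remaining upper ones.
\<close>

definition contract :: "nat \<Rightarrow> nat \<Rightarrow> (nat \<times> nat) set \<Rightarrow> 'v tensor \<Rightarrow> 'v tensor" where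
  "contract P Q M t = (\<lambda>fs vs.
     if length fs = P - card M \<and> length vs = Q - card M then
       (\<Sum>b \<in> Domain M \<rightarrow>\<^sub>E Basis.
          t (map (\<lambda>i. if i \<in> Domain M then dual_basis (b i)
                      else fs ! card ({..<i} - Domain M)) [0..<P])
            (map (\<lambda>j. if j \<in> Range M then b (THE i. (i, j) \<in> M)
                      else vs ! card ({..<j} - Range M)) [0..<Q]))
     else 0)"

text \<open>
  In a tensor product of tensors with \<open>p\<close> and \<open>p'\<close> upper and \<open>q\<close> and \<open>q'\<close> lower indices, the
  upper index \<open>i\<close> belongs to the first factor iff \<open>i < p\<close>, the lower index \<open>j\<close> iff \<open>j < q\<close>.
\<close>

definition cross_pairings :: "nat \<Rightarrow> nat \<Rightarrow> nat \<Rightarrow> nat \<Rightarrow> (nat \<times> nat) set set" where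
  "cross_pairings p q p' q' =
     {M. M \<subseteq> {..<p + p'} \<times> {..<q + q'} \<and> inj_on fst M \<and> inj_on snd M \<and>
         (\<forall>(i, j) \<in> M. (i < p) \<noteq> (j < q))}"

definition elementary_contractions :: "('v tensor \<Rightarrow> 'v tensor \<Rightarrow> 'v tensor) set" where
  "elementary_contractions =
     {\<lambda>X Y. contract (p + p') (q + q') M
              (tensor_prod p q (component p q X) (component p' q' Y)) |p q p' q' M.
        (p, q) \<in> {(1, 2), (2, 1)} \<and> (p', q') \<in> {(1, 2), (2, 1)} \<and> M \<in> cross_pairings p q p' q'}"

definition binary_operation :: "('v tensor \<Rightarrow> 'v tensor \<Rightarrow> 'v tensor) \<Rightarrow> bool" where
  "binary_operation \<tau> \<longleftrightarrow>
     (\<exists>S c. finite S \<and> S \<subseteq> elementary_contractions \<and>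
        (\<forall>X\<in>\<A>. \<forall>Y\<in>\<A>. \<tau> X Y = (\<Sum>\<epsilon>\<in>S. smul (c \<epsilon>) (\<epsilon> X Y))))"

lemma vector_space_complex: "vector_space ((*) :: complex \<Rightarrow> complex \<Rightarrow> complex)"
  by unfold_locales (auto simp: algebra_simps)

lemma linear_form_iff:
  "Vector_Spaces.linear scale (*) f \<longleftrightarrow>
     (\<forall>u v. f (u + v) = f u + f v) \<and> (\<forall>c v. f (scale c v) = c * f v)"
  unfolding Vector_Spaces.linear_iff using vector_space_complex vector_space_axioms by auto

lemma dual_basis_in_covectors: "dual_basis b \<in> covectors"
  unfolding covectors_def dual_basis_def mem_Collect_eq linear_form_iff
  by (auto simp: representation_add representation_scale independent_Basis span_Basis)

text \<open>
  The linear map from \<open>V\<^sup>\<otimes>\<^sup>q\<close> to \<open>V\<^sup>\<otimes>\<^sup>p\<close> given by a tensor in \<open>tensors p q\<close>, where elements of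
  \<open>V\<^sup>\<otimes>\<^sup>q\<close> are multilinear forms on \<open>q\<close> covectors.  The lemmas below show that its value on
  the decomposable tensor \<open>pure vs\<close> is \<open>\<lambda>fs. t fs vs\<close>, and that \<open>tensor_comp\<close> is
  the composition of these maps.
\<close>

definition hom_of :: "nat \<Rightarrow> 'v tensor \<Rightarrow>
    (('v \<Rightarrow> complex) list \<Rightarrow> complex) \<Rightarrow> (('v \<Rightarrow> complex) list \<Rightarrow> complex)" where
  "hom_of q t w = (\<lambda>fs. \<Sum>bs\<in>basis_lists q. t fs bs * w (map dual_basis bs))"

definition pure :: "'v list \<Rightarrow> ('v \<Rightarrow> complex) list \<Rightarrow> complex" where
  "pure vs fs = (if length fs = length vs \<and> set fs \<subseteq> covectors
                 then \<Prod>i<length vs. (fs ! i) (vs ! i) else 0)"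

lemma hom_of_tensor_comp: "hom_of r (tensor_comp q s t) w = hom_of q s (hom_of r t w)"
proof
  fix fs
  show "hom_of r (tensor_comp q s t) w fs = hom_of q s (hom_of r t w) fs"
    unfolding hom_of_def tensor_comp_def sum_distrib_left sum_distrib_right
    by (subst sum.swap) (simp add: mult.assoc)
qed

lemma basis_lists_Suc: "basis_lists (Suc q) = (\<lambda>(b, bs). b # bs) ` (Basis \<times> basis_lists q)"
  by (auto simp: basis_lists_def image_iff length_Suc_conv)

lemma finite_basis_lists: "finite (basis_lists q)"
  unfolding basis_lists_def using finite_Basis by (rule finite_lists_length_eq)

lemma sum_basis_lists_Suc:
  "(\<Sum>bs\<in>basis_lists (Suc q). F bs) = (\<Sum>b\<in>Basis. \<Sum>bs\<in>basis_lists q. F (b # bs))"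
  unfolding basis_lists_Suc
  by (subst sum.reindex) (auto simp: inj_on_def sum.cartesian_product case_prod_unfold)

lemma linear_form_expand:
  assumes "Vector_Spaces.linear scale (*) f"
  shows "f v = (\<Sum>b\<in>Basis. f b * dual_basis b v)"
proof -
  have f: "f (u + v) = f u + f v" "f (scale c v) = c * f v" for u v c
    using assms unfolding linear_form_iff by auto
  have f0: "f 0 = 0" using f(2)[of 0 0] by simp
  have fs: "f (sum g S) = (\<Sum>x\<in>S. f (g x))" if "finite S" for g :: "'v \<Rightarrow> 'v" and S
    using that by induction (auto simp: f f0)
  have "v = (\<Sum>b\<in>Basis. scale (representation Basis v b) b)"
    using sum_representation_eq[OF independent_Basis _ finite_Basis, of v] span_Basis by simp
  then have "f v = f (\<Sum>b\<in>Basis. scale (representation Basis v b) b)" by simp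
  then show ?thesis by (simp add: fs finite_Basis f dual_basis_def mult.commute)
qed

lemma multilinear_expand:
  assumes "\<And>vs i. i < length vs \<Longrightarrow> Vector_Spaces.linear scale (*) (\<lambda>v. F (vs[i := v]))"
  shows "F vs = (\<Sum>bs\<in>basis_lists (length vs). F bs * (\<Prod>i<length vs. dual_basis (bs ! i) (vs ! i)))"
  using assms
proof (induction vs arbitrary: F)
  case Nil
  have "basis_lists 0 = {[]}" by (auto simp: basis_lists_def)
  then show ?case by simp
next
  case (Cons v vs)
  have "F (v # vs) = (\<Sum>b\<in>Basis. F (b # vs) * dual_basis b v)"
    using linear_form_expand[OF Cons.prems[of 0 "v # vs"], of v]
    by (simp only: list_update_code length_Cons zero_less_Suc)
  moreover have "F (b # vs) = (\<Sum>bs\<in>basis_lists (length vs). F (b # bs) *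
      (\<Prod>i<length vs. dual_basis (bs ! i) (vs ! i)))" for b
  proof (rule Cons.IH)
    fix ws :: "'v list" and i assume "i < length ws"
    then show "Vector_Spaces.linear scale (*) (\<lambda>v. F (b # ws[i := v]))"
      using Cons.prems[of "Suc i" "b # ws"] by simp
  qed
  ultimately show ?case
    by (simp add: sum_basis_lists_Suc prod.lessThan_Suc_shift sum_distrib_right sum_distrib_left ac_simps
        del: prod.lessThan_Suc)
qed

lemma hom_of_pure:
  assumes "t \<in> tensors p q" "length vs = q"
  shows "hom_of q t (pure vs) = (\<lambda>fs. t fs vs)"
proof
  fix fs
  have *: "pure vs (map dual_basis bs) = (\<Prod>i<length vs. dual_basis (bs ! i) (vs ! i))"
    if "bs \<in> basis_lists q" for bs
    using that assms dual_basis_in_covectors by (auto simp: pure_def basis_lists_def)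
  show "hom_of q t (pure vs) fs = t fs vs"
    unfolding hom_of_def
    by (subst multilinear_expand[where F = "t fs" and vs = vs])
       (use assms * in \<open>auto simp: tensors_def\<close>)
qed

lemma covectors_comb:
  assumes "f \<in> covectors" "g \<in> covectors"
  shows "(\<lambda>v. c * f v + g v) \<in> covectors"
  using assms unfolding covectors_def mem_Collect_eq linear_form_iff by (auto simp: algebra_simps)

lemma pairing_in_tensors:
  assumes kl: "k < 2" "l < 2" "k \<noteq> (l :: nat)"
  shows "(\<lambda>fs vs. if length fs = 2 \<and> length vs = 2 \<and> set fs \<subseteq> covectors
                 then (fs ! 0) (vs ! k) * (fs ! 1) (vs ! l) else 0) \<in> tensors 2 2"
    (is "?t \<in> _")
  unfolding tensors_def mem_Collect_eq linear_form_iff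
proof (intro conjI allI impI; (elim conjE)?)
  fix fs vs assume "?t fs vs \<noteq> 0"
  then show "length fs = 2" "length vs = 2" "set fs \<subseteq> covectors"
    by (auto split: if_splits)
next
  fix fs and vs :: "'v list" and i f g c
  assume fs: "set fs \<subseteq> covectors" "i < length fs" and fg: "f \<in> covectors" "g \<in> covectors"
  have upd: "set (fs[i := h]) \<subseteq> covectors" if "h \<in> covectors" for h
    using fs that by (intro set_update_subsetI)
  note upd' = upd[OF fg(1)] upd[OF fg(2)] upd[OF covectors_comb[OF fg]]
  show "?t (fs[i := \<lambda>v. c * f v + g v]) vs = c * ?t (fs[i := f]) vs + ?t (fs[i := g]) vs"
  proof (cases "length fs = 2 \<and> length vs = 2")
    case True
    then have "i = 0 \<or> i = 1" using fs by auto
    then show ?thesis using True upd' by (elim disjE) (simp_all add: algebra_simps)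
  qed auto
next
  fix fs and vs :: "'v list" and i u v assume i: "i < length vs"
  show "?t fs (vs[i := u + v]) = ?t fs (vs[i := u]) + ?t fs (vs[i := v])"
  proof (cases "length fs = 2 \<and> length vs = 2 \<and> set fs \<subseteq> covectors")
    case True
    then have "fs ! 0 \<in> covectors" "fs ! 1 \<in> covectors" by (auto intro!: subsetD[OF _ nth_mem])
    moreover have "i = k \<or> i = l" using i True kl by auto
    ultimately show ?thesis using True kl i
      by (elim disjE) (simp_all add: covectors_def linear_form_iff algebra_simps)
  qed auto
next
  fix fs and vs :: "'v list" and i c v assume i: "i < length vs"
  show "?t fs (vs[i := scale c v]) = c * ?t fs (vs[i := v])"
  proof (cases "length fs = 2 \<and> length vs = 2 \<and> set fs \<subseteq> covectors")
    case True
    then have "fs ! 0 \<in> covectors" "fs ! 1 \<in> covectors" by (auto intro!: subsetD[OF _ nth_mem])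
    moreover have "i = k \<or> i = l" using i True kl by auto
    ultimately show ?thesis using True kl i
      by (elim disjE) (simp_all add: covectors_def linear_form_iff algebra_simps)
  qed auto
qed

lemma id2_in_tensors: "id2 \<in> tensors 2 2"
  unfolding id2_def by (rule pairing_in_tensors) auto

lemma flip_in_tensors: "flip \<in> tensors 2 2"
  unfolding flip_def by (rule pairing_in_tensors) auto

lemma hom_of_flip: "hom_of 2 flip (pure [u, v]) = pure [v, u]"
  by (subst hom_of_pure[OF flip_in_tensors])
     (auto simp: flip_def pure_def fun_eq_iff numeral_2_eq_2)

lemma hom_of_id2: "hom_of 2 id2 (pure [u, v]) = pure [u, v]"
  by (subst hom_of_pure[OF id2_in_tensors])
     (auto simp: id2_def pure_def fun_eq_iff numeral_2_eq_2)

lemma tensors_support: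
  assumes "t \<in> tensors p q" "t fs vs \<noteq> 0"
  shows "length fs = p" "length vs = q" "set fs \<subseteq> covectors"
proof -
  have "\<forall>fs vs. t fs vs \<noteq> 0 \<longrightarrow> length fs = p \<and> length vs = q \<and> set fs \<subseteq> covectors"
    using assms(1) unfolding tensors_def mem_Collect_eq by (rule conjunct1)
  with assms(2) show "length fs = p" "length vs = q" "set fs \<subseteq> covectors" by auto
qed

lemma tensors_upper:
  assumes "t \<in> tensors p q" "set fs \<subseteq> covectors" "i < length fs" "f \<in> covectors" "g \<in> covectors"
  shows "t (fs[i := \<lambda>v. c * f v + g v]) vs = c * t (fs[i := f]) vs + t (fs[i := g]) vs"
proof -
  have "\<forall>fs vs i f g c.
      set fs \<subseteq> covectors \<and> i < length fs \<and> f \<in> covectors \<and> g \<in> covectors \<longrightarrow>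
      t (fs[i := \<lambda>v. c * f v + g v]) vs = c * t (fs[i := f]) vs + t (fs[i := g]) vs"
    using assms(1) unfolding tensors_def mem_Collect_eq by (elim conjE)
  with assms(2-) show ?thesis by simp
qed

lemma tensors_lower:
  assumes "t \<in> tensors p q" "i < length vs"
  shows "t fs (vs[i := u + v]) = t fs (vs[i := u]) + t fs (vs[i := v])"
    and "t fs (vs[i := scale c v]) = c * t fs (vs[i := v])"
proof -
  have "\<forall>fs vs i. i < length vs \<longrightarrow> Vector_Spaces.linear scale (*) (\<lambda>v. t fs (vs[i := v]))"
    using assms(1) unfolding tensors_def mem_Collect_eq by (elim conjE)
  with assms(2) have "Vector_Spaces.linear scale (*) (\<lambda>v. t fs (vs[i := v]))" by simp
  then show "t fs (vs[i := u + v]) = t fs (vs[i := u]) + t fs (vs[i := v])"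
    "t fs (vs[i := scale c v]) = c * t fs (vs[i := v])"
    by (simp_all only: linear_form_iff)
qed

lemma tensors_0: "0 \<in> tensors p q"
  by (auto simp: tensors_def linear_form_iff)

lemma tensors_add:
  assumes s: "s \<in> tensors p q" and t: "t \<in> tensors p q" shows "s + t \<in> tensors p q"
  unfolding tensors_def mem_Collect_eq linear_form_iff
proof (intro conjI allI impI; (elim conjE)?)
  fix fs vs assume "(s + t) fs vs \<noteq> 0"
  then have "s fs vs \<noteq> 0 \<or> t fs vs \<noteq> 0" by auto
  then show "length fs = p" "length vs = q" "set fs \<subseteq> covectors"
    using tensors_support[OF s] tensors_support[OF t] by blast+
qed (simp_all only: plus_fun_apply tensors_upper[OF s] tensors_upper[OF t] tensors_lower[OF s]
      tensors_lower[OF t], simp_all add: algebra_simps)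

lemma tensors_smul:
  assumes t: "t \<in> tensors p q" shows "smul c t \<in> tensors p q"
  unfolding tensors_def mem_Collect_eq linear_form_iff
proof (intro conjI allI impI; (elim conjE)?)
  fix fs vs assume "smul c t fs vs \<noteq> 0"
  then have "t fs vs \<noteq> 0" by (auto simp: smul_def)
  then show "length fs = p" "length vs = q" "set fs \<subseteq> covectors"
    using tensors_support[OF t] by blast+
qed (simp_all add: smul_def tensors_upper[OF t] tensors_lower[OF t] distrib_left mult.left_commute)

lemma tensors_comp:
  assumes s: "s \<in> tensors p q" and t: "t \<in> tensors q r"
  shows "tensor_comp q s t \<in> tensors p r"
  unfolding tensors_def mem_Collect_eq linear_form_iff
proof (intro conjI allI impI; (elim conjE)?)
  fix fs vs assume "tensor_comp q s t fs vs \<noteq> 0"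
  then obtain bs where "s fs bs * t (map dual_basis bs) vs \<noteq> 0"
    unfolding tensor_comp_def by (meson sum.not_neutral_contains_not_neutral)
  then have "s fs bs \<noteq> 0" "t (map dual_basis bs) vs \<noteq> 0" by auto
  then show "length fs = p" "length vs = r" "set fs \<subseteq> covectors"
    using tensors_support[OF s] tensors_support[OF t] by simp_all
next
  fix fs vs i f g c
  assume "set fs \<subseteq> covectors" "i < length fs" "f \<in> covectors" "g \<in> covectors"
  then have "s (fs[i := \<lambda>v. c * f v + g v]) bs = c * s (fs[i := f]) bs + s (fs[i := g]) bs" for bs
    by (rule tensors_upper[OF s])
  then show "tensor_comp q s t (fs[i := \<lambda>v. c * f v + g v]) vs =
      c * tensor_comp q s t (fs[i := f]) vs + tensor_comp q s t (fs[i := g]) vs"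
    unfolding tensor_comp_def by (simp add: sum_distrib_left sum.distrib algebra_simps)
next
  fix fs vs i u v assume "i < length (vs :: 'v list)"
  then have "t gs (vs[i := u + v]) = t gs (vs[i := u]) + t gs (vs[i := v])" for gs
    by (rule tensors_lower[OF t])
  then show "tensor_comp q s t fs (vs[i := u + v]) =
      tensor_comp q s t fs (vs[i := u]) + tensor_comp q s t fs (vs[i := v])"
    unfolding tensor_comp_def by (simp add: sum.distrib algebra_simps)
next
  fix fs vs i c v assume "i < length (vs :: 'v list)"
  then have "t gs (vs[i := scale c v]) = c * t gs (vs[i := v])" for gs
    by (rule tensors_lower[OF t])
  then show "tensor_comp q s t fs (vs[i := scale c v]) = c * tensor_comp q s t fs (vs[i := v])"
    unfolding tensor_comp_def by (simp add: sum_distrib_left algebra_simps)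
qed

lemma component_in_tensors:
  assumes "X \<in> \<A>"
  shows "component 1 2 X \<in> tensors 1 2" "component 2 1 X \<in> tensors 2 1"
    and "X = component 1 2 X + component 2 1 X"
proof -
  obtain s t where st: "s \<in> tensors 1 2" "t \<in> tensors 2 1" and X: "X = s + t"
    using assms unfolding \<A>_def by blast
  have z: "s fs vs = 0" if "\<not> (length fs = 1 \<and> length vs = 2)" for fs vs
    using tensors_support[OF st(1)] that by blast
  have z': "t fs vs = 0" if "\<not> (length fs = 2 \<and> length vs = 1)" for fs vs
    using tensors_support[OF st(2)] that by blast
  have "component 1 2 X = s" "component 2 1 X = t"
    using z z' by (auto simp: component_def X fun_eq_iff)
  then show "component 1 2 X \<in> tensors 1 2" "component 2 1 X \<in> tensors 2 1"
    "X = component 1 2 X + component 2 1 X"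
    using st X by auto
qed

lemma three_commutator_in_\<A>:
  assumes "X \<in> \<A>" "Y \<in> \<A>" "Z \<in> \<A>"
  shows "three_commutator \<alpha> \<beta> \<gamma> X Y Z \<in> \<A>"
proof -
  have N: "id2 + flip \<in> tensors 2 2"
    by (intro tensors_add id2_in_tensors flip_in_tensors)
  have t21: "triple21 X Y Z \<in> tensors 2 1" if "X \<in> \<A>" "Y \<in> \<A>" "Z \<in> \<A>" for X Y Z
    unfolding triple21_def using that N by (intro tensors_comp component_in_tensors)
  have t12: "triple12 X Y Z \<in> tensors 1 2" if "X \<in> \<A>" "Y \<in> \<A>" "Z \<in> \<A>" for X Y Z
    unfolding triple12_def using that N by (intro tensors_comp component_in_tensors)
  define s where "s = smul \<alpha> (triple12 X Y Z) + smul \<alpha> (triple12 Z Y X)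
   + smul \<beta> (triple12 Z X Y) + smul \<beta> (triple12 Y X Z)
   + smul \<gamma> (triple12 X Z Y) + smul \<gamma> (triple12 Y Z X)"
  define t where "t = smul \<alpha> (triple21 X Y Z) + smul \<alpha> (triple21 Z Y X)
   + smul \<beta> (triple21 Z X Y) + smul \<beta> (triple21 Y X Z)
   + smul \<gamma> (triple21 X Z Y) + smul \<gamma> (triple21 Y Z X)"
  have "s \<in> tensors 1 2"
    unfolding s_def using assms by (intro tensors_add tensors_smul t12)
  moreover have "t \<in> tensors 2 1"
    unfolding t_def using assms by (intro tensors_add tensors_smul t21)
  moreover have "three_commutator \<alpha> \<beta> \<gamma> X Y Z = s + t"
    unfolding three_commutator_def s_def t_def by (simp add: add_ac)
  ultimately show ?thesis unfolding \<A>_def by blast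
qed

end

end

theory Submission
  imports Defs
begin

text \<open>
  Every index contraction lowers the total number of indices by two, so a binary contraction of
  two tensors with three indices each has an even number of indices and lies in \<open>\<A>\<close> only if it
  vanishes.  For the identity, the sum \<open>chain3\<close> of the two linear triple products
  is totally associative, so that all terms are combinations of the words of length five in
  \<open>A, B, C, D, E\<close>.  Collect them by powers of the cube root of unity \<open>\<omega>\<close>: in the sum over all
  twenty terms each of the 120 words occurs twice with each of \<open>1\<close>, \<open>\<omega>\<close>, \<open>\<omega>\<^sup>2\<close>, and
  \<open>1 + \<omega> + \<omega>\<^sup>2 = 0\<close>.
\<close>

lemma smul_add: "smul c (s + t) = smul c s + smul c t"
  by (simp add: smul_def fun_eq_iff distrib_left)

lemma smul_smul: "smul c (smul d t) = smul (c * d) t"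
  by (simp add: smul_def mult.assoc)

lemma smul_one: "smul 1 t = t"
  by (simp add: smul_def)

lemma component_add: "component p q (s + t) = component p q s + component p q t"
  by (auto simp: component_def fun_eq_iff)

lemma component_smul: "component p q (smul c t) = smul c (component p q t)"
  by (auto simp: component_def smul_def fun_eq_iff)

context fin_dim_complex_space
begin

section \<open>Parity of the number of indices under binary contractions\<close>

lemma contract_odd_eq_0:
  assumes M: "M \<in> cross_pairings p q p' q'"
    and parity: "even (p + q + p' + q')" "odd (length fs + length vs)"
  shows "contract (p + p') (q + q') M t fs vs = 0"
proof -
  have M': "M \<subseteq> {..<p + p'} \<times> {..<q + q'}" "inj_on fst M" "inj_on snd M"
    using M by (auto simp: cross_pairings_def)
  \<comment> \<open>Disjointness of the pairs bounds \<open>card M\<close> by both numbers of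
    indices, so the truncated subtractions in \<open>contract\<close> are genuine and each pair
    removes exactly two indices.\<close>
  have "card M = card (fst ` M)" "card M = card (snd ` M)"
    using M' by (simp_all add: card_image)
  moreover have "card (fst ` M) \<le> card {..<p + p'}" "card (snd ` M) \<le> card {..<q + q'}"
    using M'(1) by (intro card_mono; force)+
  ultimately have le: "card M \<le> p + p'" "card M \<le> q + q'" by simp_all
  have "\<not> (length fs = p + p' - card M \<and> length vs = q + q' - card M)"
  proof
    assume "length fs = p + p' - card M \<and> length vs = q + q' - card M"
    then have "length fs + length vs + 2 * card M = p + q + p' + q'"
      using le by linarith
    with parity show False by presburger
  qed
  then show ?thesis unfolding contract_def by (rule if_not_P)
qed

text \<open>Each factor is homogeneous with three indices, so six indices are present before
  contraction.\<close>

lemma elementary_contraction_odd_eq_0: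
  assumes "\<epsilon> \<in> elementary_contractions" "odd (length fs + length vs)"
  shows "\<epsilon> X Y fs vs = 0"
  using assms contract_odd_eq_0 unfolding elementary_contractions_def by fastforce

lemma binary_operation_odd_eq_0:
  assumes "binary_operation \<tau>" "X \<in> \<A>" "Y \<in> \<A>" "odd (length fs + length vs)"
  shows "\<tau> X Y fs vs = 0"
proof -
  obtain S c where S: "finite S" "S \<subseteq> elementary_contractions"
    and \<tau>: "\<tau> X Y = (\<Sum>\<epsilon>\<in>S. smul (c \<epsilon>) (\<epsilon> X Y))"
    using assms(1-3) unfolding binary_operation_def by blast
  have "(\<Sum>\<epsilon>\<in>S. smul (c \<epsilon>) (\<epsilon> X Y)) fs vs = (\<Sum>\<epsilon>\<in>S. smul (c \<epsilon>) (\<epsilon> X Y) fs vs)"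
    using S(1) by induction auto
  also have "\<dots> = 0"
    using S(2) elementary_contraction_odd_eq_0[OF _ assms(4)]
    by (intro sum.neutral) (auto simp: smul_def)
  finally show ?thesis by (simp add: \<tau>)
qed

lemma \<A>_even_eq_0:
  assumes "X \<in> \<A>" "even (length fs + length vs)"
  shows "X fs vs = 0"
proof -
  have "X fs vs = component 1 2 X fs vs + component 2 1 X fs vs"
    using component_in_tensors(3)[OF assms(1)] by (metis plus_fun_apply)
  with assms(2) show ?thesis
    unfolding component_def by (smt (verit) add_0 odd_one odd_add even_numeral)
qed

text \<open>A value in \<A> would live in odd total degree only, while the operation produces even
  total degree only; the two supports are disjoint.\<close>

lemma binary_operation_not_into_\<A>:
  assumes "binary_operation \<tau>" "X \<in> \<A>" "Y \<in> \<A>" "\<tau> X Y \<noteq> 0"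
  shows "\<tau> X Y \<notin> \<A>"
proof
  assume "\<tau> X Y \<in> \<A>"
  then have "\<tau> X Y fs vs = 0" for fs vs
    using \<A>_even_eq_0 binary_operation_odd_eq_0[OF assms(1-3)] by (cases "even (length fs + length vs)") auto
  with assms(4) show False by (auto simp: fun_eq_iff)
qed

section \<open>Associativity of the chain product\<close>

lemma tensor_comp_assoc:
  "tensor_comp q (tensor_comp p r s) t = tensor_comp p r (tensor_comp q s t)"
  unfolding tensor_comp_def sum_distrib_left sum_distrib_right fun_eq_iff
  by (intro allI, subst sum.swap) (simp add: mult.assoc)

lemma tensor_comp_add_left: "tensor_comp q (r + s) t = tensor_comp q r t + tensor_comp q s t"
  by (simp add: tensor_comp_def fun_eq_iff distrib_right sum.distrib)

lemma tensor_comp_add_right: "tensor_comp q r (s + t) = tensor_comp q r s + tensor_comp q r t"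
  by (simp add: tensor_comp_def fun_eq_iff distrib_left sum.distrib)

lemma tensor_comp_smul_left: "tensor_comp q (smul c s) t = smul c (tensor_comp q s t)"
  by (simp add: tensor_comp_def smul_def fun_eq_iff sum_distrib_left mult.assoc)

lemma tensor_comp_smul_right: "tensor_comp q s (smul c t) = smul c (tensor_comp q s t)"
  by (simp add: tensor_comp_def smul_def fun_eq_iff sum_distrib_left mult.left_commute)

lemmas tensor_comp_linear =
  tensor_comp_add_left tensor_comp_add_right tensor_comp_smul_left tensor_comp_smul_right

text \<open>The degree is read off the outer factors: the leftmost one fixes the number of
  covectors, the rightmost one the number of vectors.\<close>

lemma component_triple21:
  "component 2 1 (triple21 X Y Z) = triple21 X Y Z" "component 1 2 (triple21 X Y Z) = 0"
  by (auto simp: triple21_def tensor_comp_def component_def fun_eq_iff intro!: sum.neutral)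

lemma component_triple12:
  "component 1 2 (triple12 X Y Z) = triple12 X Y Z" "component 2 1 (triple12 X Y Z) = 0"
  by (auto simp: triple12_def tensor_comp_def component_def fun_eq_iff intro!: sum.neutral)

definition chain3 :: "'v tensor \<Rightarrow> 'v tensor \<Rightarrow> 'v tensor \<Rightarrow> 'v tensor" where
  "chain3 X Y Z = triple21 X Y Z + triple12 X Y Z"

lemma component_chain3:
  "component 2 1 (chain3 X Y Z) = triple21 X Y Z"
  "component 1 2 (chain3 X Y Z) = triple12 X Y Z"
  unfolding chain3_def component_add component_triple21 component_triple12 by simp_all

lemma chain3_linear:
  "chain3 (X + X') Y Z = chain3 X Y Z + chain3 X' Y Z"
  "chain3 X (Y + Y') Z = chain3 X Y Z + chain3 X Y' Z"
  "chain3 X Y (Z + Z') = chain3 X Y Z + chain3 X Y Z'"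
  "chain3 (smul c X) Y Z = smul c (chain3 X Y Z)"
  "chain3 X (smul c Y) Z = smul c (chain3 X Y Z)"
  "chain3 X Y (smul c Z) = smul c (chain3 X Y Z)"
  unfolding chain3_def triple21_def triple12_def
    component_add component_smul tensor_comp_linear smul_add
  by (simp_all only: add_ac)

text \<open>With \<open>N = id2 + flip\<close>, every bracketing has the (2,1) part
  \<open>X21 Y12 N Z21 U12 N W21\<close> and the (1,2) part \<open>X12 N Y21 Z12 N U21 W12\<close>.
  The middle bracketing inserts the triple product of the opposite type, which is why both types are
  summed. As rewrite rules the equations lead to the left-nested form used in
  \<open>chain5\<close>.\<close>

lemma chain3_assoc:
  "chain3 X (chain3 Y Z U) W = chain3 (chain3 X Y Z) U W"
  "chain3 X Y (chain3 Z U W) = chain3 (chain3 X Y Z) U W"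
proof -
  have "triple21 X (chain3 Y Z U) W = triple21 (chain3 X Y Z) U W"
    "triple21 X Y (chain3 Z U W) = triple21 (chain3 X Y Z) U W"
    \<comment> \<open>Only the outer products are opened at first, so that
      \<open>component_chain3\<close> can still recognize the inner ones.\<close>
    unfolding triple21_def[of X "chain3 Y Z U" W] triple21_def[of "chain3 X Y Z" U W]
      triple21_def[of X Y "chain3 Z U W"] component_chain3
    unfolding triple21_def triple12_def tensor_comp_assoc by simp_all
  moreover have "triple12 X (chain3 Y Z U) W = triple12 (chain3 X Y Z) U W"
    "triple12 X Y (chain3 Z U W) = triple12 (chain3 X Y Z) U W"
    unfolding triple12_def[of X "chain3 Y Z U" W] triple12_def[of "chain3 X Y Z" U W]
      triple12_def[of X Y "chain3 Z U W"] component_chain3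
    unfolding triple21_def triple12_def tensor_comp_assoc by simp_all
  ultimately show "chain3 X (chain3 Y Z U) W = chain3 (chain3 X Y Z) U W"
    "chain3 X Y (chain3 Z U W) = chain3 (chain3 X Y Z) U W"
    by (simp_all only: chain3_def)
qed

section \<open>Words of the nested bracket and their multiplicities\<close>

text \<open>The coefficient of a word depends only on its middle letter: \<alpha> for
  \<open>Y\<close>, \<beta> for \<open>X\<close>, \<gamma> for \<open>Z\<close>.\<close>

lemma three_commutator_chain3:
  "three_commutator \<alpha> \<beta> \<gamma> X Y Z =
     smul \<alpha> (chain3 X Y Z + chain3 Z Y X) + smul \<beta> (chain3 Z X Y + chain3 Y X Z)
   + smul \<gamma> (chain3 X Z Y + chain3 Y Z X)"
  by (simp add: three_commutator_def chain3_def smul_add add_ac)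

definition chain5 ::
  "'v tensor \<Rightarrow> 'v tensor \<Rightarrow> 'v tensor \<Rightarrow> 'v tensor \<Rightarrow> 'v tensor \<Rightarrow> 'v tensor" where
  "chain5 A B C D E = chain3 (chain3 A B C) D E"

end

text \<open>The parts of the nested bracket of \<open>((A, B, C), D, E)\<close> with coefficients \<open>1\<close>, \<open>\<omega>\<close>, \<open>\<omega>\<^sup>2\<close>.\<close>

definition nested_part0 ::
  "('a \<Rightarrow> 'a \<Rightarrow> 'a \<Rightarrow> 'a \<Rightarrow> 'a \<Rightarrow> 'b::ab_semigroup_add) \<Rightarrow> 'a \<Rightarrow> 'a \<Rightarrow> 'a \<Rightarrow> 'a \<Rightarrow> 'a \<Rightarrow> 'b" where
  "nested_part0 w A B C D E =
     w A B C D E + w E D A B C + w C B A D E + w E D C B A +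
     w C A B E D + w D E C A B + w B A C E D + w D E B A C +
     w E A C B D + w D A C B E + w E B C A D + w D B C A E"

definition nested_part1 ::
  "('a \<Rightarrow> 'a \<Rightarrow> 'a \<Rightarrow> 'a \<Rightarrow> 'a \<Rightarrow> 'b::ab_semigroup_add) \<Rightarrow> 'a \<Rightarrow> 'a \<Rightarrow> 'a \<Rightarrow> 'a \<Rightarrow> 'a \<Rightarrow> 'b" where
  "nested_part1 w A B C D E =
     w E A B C D + w D A B C E + w E C B A D + w D C B A E +
     w C A B D E + w E D C A B + w B A C D E + w E D B A C +
     w A C B E D + w D E A C B + w B C A E D + w D E B C A"

definition nested_part2 ::
  "('a \<Rightarrow> 'a \<Rightarrow> 'a \<Rightarrow> 'a \<Rightarrow> 'a \<Rightarrow> 'b::ab_semigroup_add) \<Rightarrow> 'a \<Rightarrow> 'a \<Rightarrow> 'a \<Rightarrow> 'a \<Rightarrow> 'a \<Rightarrow> 'b" where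
  "nested_part2 w A B C D E =
     w A B C E D + w D E A B C + w C B A E D + w D E C B A +
     w E C A B D + w D C A B E + w E B A C D + w D B A C E +
     w A C B D E + w E D A C B + w B C A D E + w E D B C A"

text \<open>Numbering the letters from 0 to 4, the argument orders are the twenty affine maps
  \<open>x -> a x + b\<close> modulo 5 with \<open>a\<close> nonzero; the rotations have
  \<open>a = 1\<close>.\<close>

definition twenty_sum ::
  "('a \<Rightarrow> 'a \<Rightarrow> 'a \<Rightarrow> 'a \<Rightarrow> 'a \<Rightarrow> 'b::ab_semigroup_add) \<Rightarrow> 'a \<Rightarrow> 'a \<Rightarrow> 'a \<Rightarrow> 'a \<Rightarrow> 'a \<Rightarrow> 'b" where
  "twenty_sum f A B C D E =
     f A B C D E + f B C D E A + f C D E A B + f D E A B C +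
     f E A B C D + f C B A E D + f B A E D C + f A E D C B +
     f E D C B A + f D C B A E + f D A C E B + f A C E B D +
     f C E B D A + f E B D A C + f B D A C E + f C A D B E +
     f A D B E C + f D B E C A + f B E C A D + f E C A D B"

text \<open>The affine group acts freely on the 120 words, with six orbits, and each part contains
  two words of every orbit. Since \<open>w\<close> is arbitrary, the proof compares multisets of
  words, which \<open>add_ac\<close> sorts.\<close>

lemma twenty_sum_nested_part:
  "twenty_sum (nested_part1 w) A B C D E = twenty_sum (nested_part0 w) A B C D E"
  "twenty_sum (nested_part2 w) A B C D E = twenty_sum (nested_part0 w) A B C D E"
  unfolding twenty_sum_def nested_part0_def nested_part1_def nested_part2_def
  by (simp_all only: add_ac)

text \<open>The nested bracket has 36 words, each weighted by an outer times an inner coefficient.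
  These products reduce to the three cube roots of unity, giving twelve words for each.\<close>

lemma (in fin_dim_complex_space) three_commutator_nested:
  assumes "\<omega> * \<omega> = \<omega>'" "\<omega> * \<omega>' = 1"
  shows "three_commutator 1 \<omega> \<omega>' (three_commutator 1 \<omega> \<omega>' A B C) D E =
    nested_part0 chain5 A B C D E + smul \<omega> (nested_part1 chain5 A B C D E)
    + smul \<omega>' (nested_part2 chain5 A B C D E)"
proof -
  have \<omega>: "\<omega>' * \<omega> = 1" "\<omega>' * \<omega>' = \<omega>"
    using assms by (metis mult.assoc mult.commute mult_1)+
  show ?thesis
    unfolding three_commutator_chain3 chain3_linear smul_add smul_smul smul_one
      chain3_assoc mult_1 mult_1_right assms \<omega>
      nested_part0_def nested_part1_def nested_part2_def chain5_def
    by (simp only: add_ac)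
qed

lemma (in fin_dim_complex_space) twenty_sum_three_commutator:
  assumes "\<omega> * \<omega> = \<omega>'" "\<omega> * \<omega>' = 1" "1 + \<omega> + \<omega>' = 0"
  shows "twenty_sum (\<lambda>A B C. three_commutator 1 \<omega> \<omega>' (three_commutator 1 \<omega> \<omega>' A B C))
    A B C D E = 0"
proof -
  define S where "S = twenty_sum (nested_part0 chain5) A B C D E"
  have "twenty_sum (\<lambda>A B C. three_commutator 1 \<omega> \<omega>' (three_commutator 1 \<omega> \<omega>' A B C)) A B C D E =
      twenty_sum (nested_part0 chain5) A B C D E
      + smul \<omega> (twenty_sum (nested_part1 chain5) A B C D E)
      + smul \<omega>' (twenty_sum (nested_part2 chain5) A B C D E)"
    unfolding twenty_sum_def three_commutator_nested[OF assms(1,2)] smul_add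
    by (simp only: add_ac)
  also have "\<dots> = smul 1 S + smul \<omega> S + smul \<omega>' S"
    by (simp only: twenty_sum_nested_part S_def smul_one)
  also have "\<dots> = smul (1 + \<omega> + \<omega>') S"
    by (simp add: smul_def fun_eq_iff distrib_right)
  also have "\<dots> = 0"
    unfolding assms(3) by (simp add: smul_def fun_eq_iff)
  finally show ?thesis .
qed

text \<open>The last equation comes from factoring \<open>\<omega>^3 - 1\<close>; the factor
  \<open>\<omega> - 1\<close> is nonzero because \<omega> has positive imaginary part.\<close>

lemma cube_root_unity:
  defines "\<omega> \<equiv> exp (2 * of_real pi * \<i> / 3)" and "\<omega>' \<equiv> exp (4 * of_real pi * \<i> / 3)"
  shows "\<omega> * \<omega> = \<omega>'" "\<omega> * \<omega>' = 1" "1 + \<omega> + \<omega>' = 0"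
proof -
  show sq: "\<omega> * \<omega> = \<omega>'"
    by (simp add: \<omega>_def \<omega>'_def mult_ac flip: exp_add)
  have "\<omega> * \<omega>' = exp (2 * of_real pi * \<i>)"
    by (simp add: \<omega>_def \<omega>'_def mult_ac flip: exp_add)
  then show one: "\<omega> * \<omega>' = 1"
    by (simp only: exp_two_pi_i)
  have "Im \<omega> = sin (2 * pi / 3)"
    by (simp add: \<omega>_def Im_exp)
  moreover have "sin (2 * pi / 3) > 0"
    by (rule sin_gt_zero) (use pi_gt_zero in auto)
  ultimately have "\<omega> \<noteq> 1" by auto
  moreover have "(\<omega> - 1) * (1 + \<omega> + \<omega>') = 0"
    using sq one by (simp add: algebra_simps)
  ultimately show "1 + \<omega> + \<omega>' = 0" by simp
qed

theorem proposition2: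
  fixes scale :: "complex \<Rightarrow> 'v::ab_group_add \<Rightarrow> 'v" and Basis :: "'v set"
  assumes "fin_dim_complex_space scale Basis"
  shows
    "let \<A> = fin_dim_complex_space.\<A> scale;
         br = fin_dim_complex_space.three_commutator scale Basis
                1 (exp (2 * of_real pi * \<i> / 3)) (exp (4 * of_real pi * \<i> / 3))
     in (\<forall>\<tau>. fin_dim_complex_space.binary_operation scale Basis \<tau> \<and>
              (\<exists>X\<in>\<A>. \<exists>Y\<in>\<A>. \<tau> X Y \<noteq> 0) \<longrightarrow>
              \<not> (\<lambda>(X, Y). \<tau> X Y) ` (\<A> \<times> \<A>) \<subseteq> \<A>) \<and>
        (\<forall>A\<in>\<A>. \<forall>B\<in>\<A>. \<forall>C\<in>\<A>. \<forall>D\<in>\<A>. \<forall>E\<in>\<A>.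
            br (br A B C) D E + br (br B C D) E A +
            br (br C D E) A B + br (br D E A) B C +
            br (br E A B) C D + br (br C B A) E D +
            br (br B A E) D C + br (br A E D) C B +
            br (br E D C) B A + br (br D C B) A E +
            br (br D A C) E B + br (br A C E) B D +
            br (br C E B) D A + br (br E B D) A C +
            br (br B D A) C E + br (br C A D) B E +
            br (br A D B) E C + br (br D B E) C A +
            br (br B E C) A D + br (br E C A) D B = 0)"
proof -
  interpret fin_dim_complex_space scale Basis by (fact assms)
  let ?br = "three_commutator 1 (exp (2 * of_real pi * \<i> / 3)) (exp (4 * of_real pi * \<i> / 3))"
  have "\<not> (\<lambda>(X, Y). \<tau> X Y) ` (\<A> \<times> \<A>) \<subseteq> \<A>"
    if "binary_operation \<tau>" "X \<in> \<A>" "Y \<in> \<A>" "\<tau> X Y \<noteq> 0" for \<tau> X Y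
    using binary_operation_not_into_\<A>[OF that] that(2,3) by auto
  \<comment> \<open>The abstraction binds the three inner letters; the last two are passed on to the
    outer bracket.\<close>
  moreover have "twenty_sum (\<lambda>A B C. ?br (?br A B C)) A B C D E = 0" for A B C D E
    using cube_root_unity by (rule twenty_sum_three_commutator)
  ultimately show ?thesis
    unfolding Let_def twenty_sum_def by blast
qed

end
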